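(* Let $n\ge 2$, let $\tau,\kappa\in\mathbb{C}$, and let $B_n(\tau)$ be the Brauer algebra over $\mathbb{C}$. The formal connection $$\bar\Omega_n=\kappa\sum_{1\le i<j\le n}(s_{i,j}-e_{i,j})\,\omega_{i,j}$$ on $Y_n\times B_n(\tau)$ is flat and $S_n$-invariant.
   Context: $Y_n=\{(z_1,\dots,z_n)\in\mathbb{C}^n: z_i\ne z_j \text{ for } i\neq j\}$, on which $S_n$ acts by permuting coordinates, and $\omega_{i,j}=d(z_i-z_j)/(z_i-z_j)$. $B_n(\tau)$ is the usual Brauer diagram algebra on $n$ strands with loop parameter $\tau$; it contains $\mathbb{C}S_n$. $s_{i,j}\in S_n\subset B_n(\tau)$ is the transposition $(i,j)$, and $e_{i,j}$ ($i\ne j$) is the Brauer diagram in which the top points $i,j$ are joined to each other, the bottom points $i,j$ are joined to each other, and every other top point $k$ is joined to the bottom point $k$. The coefficients of the connection act on $B_n(\tau)$ by left multiplication; flat sections $F$ are solutions of $dF=\bar\Omega_n F$, and flatness means $d\bar\Omega_n-\bar\Omega_n\wedge\bar\Omega_n=0$. A connection $\sum_{i<j}X_{i,j}\omega_{i,j}$ (with $X_{j,i}=X_{i,j}\in B_n(\tau)$) is $S_n$-invariant if $w X_{i,j}w^{-1}=X_{w(i),w(j)}$ for all $w\in S_n$ and all $i\neq j$. *)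

theory Defs
  imports "HOL-Analysis.Analysis" "HOL-Combinatorics.Perm" "HOL-Combinatorics.Cycles"
begin

unbundle permutation_syntax

section \<open>Brauer diagrams\<close>

text \<open>
  The strands are indexed by a finite type \<open>'n\<close>, so \<open>n\<close> is \<open>CARD('n)\<close>.  The top point with
  index \<open>i\<close> is \<open>Inl i\<close>, the bottom point with index \<open>i\<close> is \<open>Inr i\<close>.  A diagram is a perfect
  matching of these \<open>2n\<close> points, represented by its set of edges.
\<close>

definition perfect_matching :: "'a set set \<Rightarrow> bool" where
  "perfect_matching P \<longleftrightarrow> partition_on UNIV P \<and> (\<forall>e\<in>P. card e = 2)"

lemma perfect_matching_iff:
  "perfect_matching P \<longleftrightarrow> (\<forall>e\<in>P. card e = 2) \<and> (\<forall>p. \<exists>!q. {p, q} \<in> P)"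
proof
  assume P: "perfect_matching P"
  have "\<exists>!q. {p, q} \<in> P" for p
  proof -
    from P obtain e where e: "e \<in> P" "p \<in> e"
      unfolding perfect_matching_def partition_on_def by blast
    with P have "card e = 2" by (auto simp: perfect_matching_def)
    with e obtain q where q: "e = {p, q}"
      by (metis card_2_iff' card_2_iff doubleton_eq_iff insert_iff singletonD)
    have "q' = q" if "{p, q'} \<in> P" for q'
    proof -
      from P have "disjoint P" by (simp add: perfect_matching_def partition_on_def)
      then have "{p, q'} = {p, q}"
        using disjointD[of P "{p, q'}" "{p, q}"] that e(1) q by auto
      then show ?thesis by (auto simp: doubleton_eq_iff)
    qed
    with e q show ?thesis by blast
  qed
  with P show "(\<forall>e\<in>P. card e = 2) \<and> (\<forall>p. \<exists>!q. {p, q} \<in> P)"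
    by (auto simp: perfect_matching_def)
next
  assume *: "(\<forall>e\<in>P. card e = 2) \<and> (\<forall>p. \<exists>!q. {p, q} \<in> P)"
  have block: "\<exists>q. f = {p, q}" if "f \<in> P" "p \<in> f" for f p
  proof -
    from * that(1) obtain a b where "f = {a, b}" by (meson card_2_iff)
    with that(2) show ?thesis by (auto simp: insert_commute)
  qed
  have "e = e'" if e: "e \<in> P" "e' \<in> P" "p \<in> e" "p \<in> e'" for e e' p
  proof -
    from block[OF e(1,3)] obtain q where q: "e = {p, q}" by blast
    from block[OF e(2,4)] obtain q' where q': "e' = {p, q'}" by blast
    from * have "\<exists>!q. {p, q} \<in> P" by blast
    with e(1,2) have "q = q'" unfolding q q' by blast
    with q q' show ?thesis by simp
  qed
  then have "disjoint P" by (intro disjointI) blast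
  moreover have "{} \<notin> P" using * by force
  moreover have "\<Union>P = UNIV"
  proof (intro UNIV_eq_I[symmetric])
    fix p from * obtain q where "{p, q} \<in> P" by blast
    then show "p \<in> \<Union>P" by blast
  qed
  ultimately show "perfect_matching P"
    using * by (simp add: perfect_matching_def partition_on_def)
qed

lemma perfect_matching_vertical:
  assumes "bij w"
  shows "perfect_matching {{Inl (w i), Inr i} | i. True}"
  unfolding perfect_matching_iff
proof (intro conjI ballI allI)
  fix e assume "e \<in> {{Inl (w i), Inr i} | i. True}"
  then show "card e = 2" by auto
next
  fix p show "\<exists>!q. {p, q} \<in> {{Inl (w i), Inr i} | i. True}"
  proof (cases p)
    case (Inl a)
    have "w i = a \<longleftrightarrow> i = inv w a" for i
      using assms by (metis bij_inv_eq_iff)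
    then have "q = Inr (inv w a)" if "{p, q} \<in> {{Inl (w i), Inr i} | i. True}" for q
      using that unfolding Inl by (auto simp: doubleton_eq_iff)
    moreover have "{p, Inr (inv w a)} \<in> {{Inl (w i), Inr i} | i. True}"
      unfolding Inl using \<open>\<And>i. w i = a \<longleftrightarrow> i = inv w a\<close> by simp metis
    ultimately show ?thesis by (intro ex1I[of _ "Inr (inv w a)"])
  next
    case (Inr a)
    have "q = Inl (w a)" if "{p, q} \<in> {{Inl (w i), Inr i} | i. True}" for q
      using that unfolding Inr by (auto simp: doubleton_eq_iff)
    moreover have "{p, Inl (w a)} \<in> {{Inl (w i), Inr i} | i. True}"
      unfolding Inr by (subst insert_commute) blast
    ultimately show ?thesis by (intro ex1I[of _ "Inl (w a)"])
  qed
qed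

typedef 'n brauer_diagram = "{P :: ('n + 'n) set set. perfect_matching P}"
  morphisms edges Brauer_diagram
  using perfect_matching_vertical[OF bij_id] by blast

setup_lifting type_definition_brauer_diagram

instance brauer_diagram :: (finite) finite
proof
  have "finite (range (edges :: 'a brauer_diagram \<Rightarrow> _))"
    by (rule finite_subset[OF subset_UNIV]) simp
  then show "finite (UNIV :: 'a brauer_diagram set)"
    by (rule finite_imageD) (simp add: edges_inject inj_on_def)
qed

text \<open>
  The diagram of a permutation \<open>w\<close> joins the bottom point \<open>i\<close> to the top point \<open>w i\<close>.  With the
  product below (left factor on top) this makes \<open>w \<mapsto> perm_diagram w\<close> multiplicative.
\<close>

lift_definition perm_diagram :: "'n perm \<Rightarrow> 'n brauer_diagram"
  is "\<lambda>w. {{Inl (w \<langle>$\<rangle> i), Inr i} | i. True}"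
  by (rule perfect_matching_vertical) simp

text \<open>Only meaningful for \<open>i \<noteq> j\<close>; the identity diagram otherwise.\<close>

lift_definition e_diagram :: "'n \<Rightarrow> 'n \<Rightarrow> 'n brauer_diagram"
  is "\<lambda>i j. (if i = j then {} else {{Inl i, Inl j}, {Inr i, Inr j}}) \<union>
            {{Inl k, Inr k} | k. i = j \<or> k \<noteq> i \<and> k \<noteq> j}"
proof -
  fix i j :: 'n
  let ?P = "(if i = j then {} else {{Inl i, Inl j}, {Inr i, Inr j}}) \<union>
            {{Inl k, Inr k} | k. i = j \<or> k \<noteq> i \<and> k \<noteq> j}"
  show "perfect_matching ?P"
    unfolding perfect_matching_iff
  proof (intro conjI ballI allI)
    fix e assume "e \<in> ?P"
    then show "card e = 2" by (auto split: if_splits)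
  next
    fix p show "\<exists>!q. {p, q} \<in> ?P"
      by (cases p; cases "i = j"; cases "p \<in> {Inl i, Inr i}"; cases "p \<in> {Inl j, Inr j}")
         (auto simp: doubleton_eq_iff)
  qed
qed

section \<open>Composition of diagrams\<close>

datatype 'n glue_point = Top 'n | Mid 'n | Bot 'n

instance glue_point :: (finite) finite
proof
  have "u \<in> range Top \<union> range Mid \<union> range Bot" for u :: "'a glue_point"
    by (cases u) auto
  then have "UNIV \<subseteq> range Top \<union> range Mid \<union> (range Bot :: 'a glue_point set)" by blast
  then show "finite (UNIV :: 'a glue_point set)" by (rule finite_subset) simp
qed

text \<open>\<open>x\<close> placed above \<open>y\<close>, the bottom points of \<open>x\<close> being identified with the top points of \<open>y\<close>.\<close>

definition glue :: "'n brauer_diagram \<Rightarrow> 'n brauer_diagram \<Rightarrow> 'n glue_point rel" where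
  "glue x y = {(case_sum Top Mid p, case_sum Top Mid q) | p q. {p, q} \<in> edges x} \<union>
              {(case_sum Mid Bot p, case_sum Mid Bot q) | p q. {p, q} \<in> edges y}"

text \<open>The connected components of the glued picture that do not reach the top or bottom row.\<close>

definition loops :: "'n brauer_diagram \<Rightarrow> 'n brauer_diagram \<Rightarrow> nat" where
  "loops x y = card {C \<in> UNIV // (glue x y)\<^sup>*. C \<subseteq> range Mid}"

text \<open>
  A path in the glued picture alternates between two involutions \<open>A\<close>, \<open>B\<close> without common fixed
  points, and the outer points are the fixed points of \<open>A\<close> or \<open>B\<close>.  The next lemma says that a
  component with an outer point has exactly two of them.
\<close>

lemma alternating_path_unique_end:
  fixes A B :: "'a::finite \<Rightarrow> 'a"
  assumes AA: "\<And>u. A (A u) = u" and BB: "\<And>u. B (B u) = u"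
    and nofix: "\<And>u. A u = u \<Longrightarrow> B u \<noteq> u" and p: "B p = p"
  shows "\<exists>!q. q \<noteq> p \<and> (p, q) \<in> {(u, v). v = A u \<or> v = B u}\<^sup>* \<and> (A q = q \<or> B q = q)"
proof -
  let ?R = "{(u, v). v = A u \<or> v = B u}"
  define T where "T = (\<lambda>u. B (A u))"
  have T_inj: "inj T" unfolding T_def by (metis AA BB injI)
  then have T_perm: "T permutes UNIV"
    by (intro bij_imp_permutes) (auto simp: finite_UNIV_inj_surj bij_def)
  have Tk_inj: "inj (T ^^ k)" for k using T_inj by (rule inj_fn)
  define m where "m = least_power T p"
  have m: "(T ^^ m) p = p" "m > 0"
    using least_power_of_permutation[of T p] T_perm
    unfolding m_def permutation_permutes by auto
  have m_mult: "(T ^^ (m * k)) p = p" for k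
  proof (induction k)
    case (Suc k)
    then show ?case by (simp add: funpow_add m)
  qed simp
  have per: "(T ^^ k) p = p \<longleftrightarrow> m dvd k" for k
    using m_mult unfolding m_def by (auto elim!: dvdE intro: least_power_minimal)
  have TA: "(T ^^ k) (A ((T ^^ k) u)) = A u" for k u
  proof (induction k arbitrary: u)
    case (Suc k)
    have "(T ^^ Suc k) (A ((T ^^ Suc k) u)) = T ((T ^^ k) (A ((T ^^ k) (T u))))"
      by (simp add: funpow_swap1)
    also have "\<dots> = A u" unfolding Suc by (simp add: T_def AA BB)
    finally show ?case .
  qed simp
  have TB: "(T ^^ k) (B ((T ^^ k) u)) = B u" for k u
  proof (induction k arbitrary: u)
    case (Suc k)
    have "(T ^^ Suc k) (B ((T ^^ Suc k) u)) = T ((T ^^ k) (B ((T ^^ k) (T u))))"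
      by (simp add: funpow_swap1)
    also have "\<dots> = B u" unfolding Suc by (simp add: T_def AA BB)
    finally show ?case .
  qed simp
  have TA1: "(T ^^ Suc k) (A ((T ^^ k) p)) = p" for k
    using TA[of k p] by (simp add: T_def AA p)
  have TB1: "(T ^^ k) (B ((T ^^ k) p)) = p" for k
    using TB[of k p] p by simp
  have fixA: "A ((T ^^ k) p) = (T ^^ k) p \<longleftrightarrow> m dvd 2 * k + 1" for k
  proof -
    have "A ((T ^^ k) p) = (T ^^ k) p
        \<longleftrightarrow> (T ^^ Suc k) (A ((T ^^ k) p)) = (T ^^ Suc k) ((T ^^ k) p)"
      using Tk_inj[of "Suc k"] by (simp only: inj_eq)
    also have "\<dots> \<longleftrightarrow> p = (T ^^ (Suc k + k)) p"
      unfolding TA1 funpow_add by simp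
    also have "\<dots> \<longleftrightarrow> m dvd 2 * k + 1"
      by (metis per add_Suc mult_2 Suc_eq_plus1)
    finally show ?thesis .
  qed
  have fixB: "B ((T ^^ k) p) = (T ^^ k) p \<longleftrightarrow> m dvd 2 * k" for k
  proof -
    have "B ((T ^^ k) p) = (T ^^ k) p
        \<longleftrightarrow> (T ^^ k) (B ((T ^^ k) p)) = (T ^^ k) ((T ^^ k) p)"
      using Tk_inj[of k] by (simp only: inj_eq)
    also have "\<dots> \<longleftrightarrow> p = (T ^^ (k + k)) p"
      unfolding TB1 funpow_add by simp
    also have "\<dots> \<longleftrightarrow> m dvd 2 * k"
      by (metis per mult_2)
    finally show ?thesis .
  qed
  have retrace: "\<exists>j. u = (T ^^ j) p" if "(T ^^ k) u = p" for u k
  proof -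
    have "(T ^^ k) ((T ^^ (m * k - k)) p) = (T ^^ (k + (m * k - k))) p"
      by (simp add: funpow_add)
    also have "k + (m * k - k) = m * k" using m(2) by (cases m) auto
    finally have "(T ^^ k) ((T ^^ (m * k - k)) p) = (T ^^ k) u" using m_mult that by simp
    then show ?thesis using Tk_inj[of k] by (metis inj_eq)
  qed
  have orbit: "\<exists>k<m. u = (T ^^ k) p" if "(p, u) \<in> ?R\<^sup>*" for u
  proof -
    from that have "\<exists>k. u = (T ^^ k) p"
    proof induction
      case base
      then show ?case by (metis funpow_0)
    next
      case (step u v)
      then obtain k where k: "u = (T ^^ k) p" by blast
      then have "(T ^^ Suc k) (A u) = p" "(T ^^ k) (B u) = p" using TA1 TB1 by auto
      with step(2) retrace show ?case by blast
    qed
    then obtain k where k: "u = (T ^^ k) p" by blast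
    have "(T ^^ k) p = (T ^^ (k mod m + m * (k div m))) p" by simp
    also have "\<dots> = (T ^^ (k mod m)) p" unfolding funpow_add by (simp add: m_mult)
    finally show ?thesis using k m(2) by (metis mod_less_divisor)
  qed
  have reach: "(p, (T ^^ k) p) \<in> ?R\<^sup>*" for k
  proof (induction k)
    case (Suc k)
    have "((T ^^ k) p, A ((T ^^ k) p)) \<in> ?R" "(A ((T ^^ k) p), (T ^^ Suc k) p) \<in> ?R"
      by (auto simp: T_def)
    with Suc show ?case by (meson rtrancl.rtrancl_into_rtrancl)
  qed simp
  have "m \<noteq> 1" using fixA[of 0] nofix[of p] p by auto
  define h where "h = m div 2"
  have h: "0 < h" "h < m" using \<open>m \<noteq> 1\<close> m(2) unfolding h_def by auto
  have "m = 2 * h \<or> m = 2 * h + 1" unfolding h_def by presburger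
  then have hfix: "A ((T ^^ h) p) = (T ^^ h) p \<or> B ((T ^^ h) p) = (T ^^ h) p"
    using fixA[of h] fixB[of h] by auto
  have hp: "(T ^^ h) p \<noteq> p" using per[of h] h by (auto dest: dvd_imp_le)
  have "q = (T ^^ h) p" if q: "q \<noteq> p" "(p, q) \<in> ?R\<^sup>*" "A q = q \<or> B q = q" for q
  proof -
    obtain k where k: "k < m" "q = (T ^^ k) p" using orbit q by blast
    have "k > 0" using k q(1) by (cases k) auto
    from q(3) k have "m dvd 2 * k + 1 \<or> m dvd 2 * k" using fixA fixB by auto
    then obtain c where c: "2 * k + 1 = m * c \<or> 2 * k = m * c" by (auto simp: dvd_def)
    have "c = 1"
    proof (rule ccontr)
      assume "c \<noteq> 1"
      then consider "c = 0" | "c \<ge> 2" by linarith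
      then show False
      proof cases
        case 2
        then have "m * 2 \<le> m * c" by (intro mult_le_mono) auto
        with c k(1) show False by linarith
      qed (use c \<open>k > 0\<close> in auto)
    qed
    with c have "k = h" unfolding h_def by auto
    with k show ?thesis by simp
  qed
  with hfix hp reach show ?thesis by blast
qed

lemma glue_unique_end:
  fixes x y :: "'n::finite brauer_diagram"
  shows "\<exists>!q. p \<noteq> q \<and> (case_sum Top Bot p, case_sum Top Bot q) \<in> (glue x y)\<^sup>*"
proof -
  define mate where "mate = (\<lambda>(x :: 'n brauer_diagram) p. THE q. {p, q} \<in> edges x)"
  have pm: "perfect_matching (edges z)" for z :: "'n brauer_diagram" using edges by auto
  have mate: "{a, b} \<in> edges z \<longleftrightarrow> b = mate z a" for z a b
    using pm[of z] unfolding perfect_matching_iff mate_def by (metis the_equality)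
  have mate_mate [simp]: "mate z (mate z a) = a" for z a
    by (metis mate insert_commute)
  have mate_ne [simp]: "mate z a \<noteq> a" for z a
  proof
    assume "mate z a = a"
    then have "{a} \<in> edges z" using mate[of a a z] by simp
    with pm[of z] show False unfolding perfect_matching_iff by force
  qed
  define A where "A = (\<lambda>u. case u of Top i \<Rightarrow> case_sum Top Mid (mate x (Inl i))
      | Mid i \<Rightarrow> case_sum Top Mid (mate x (Inr i)) | Bot i \<Rightarrow> Bot i)"
  define B where "B = (\<lambda>u. case u of Top i \<Rightarrow> Top i
      | Mid i \<Rightarrow> case_sum Mid Bot (mate y (Inl i)) | Bot i \<Rightarrow> case_sum Mid Bot (mate y (Inr i)))"
  have A1: "A (case_sum Top Mid a) = case_sum Top Mid (mate x a)" for a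
    by (cases a) (auto simp: A_def)
  have B1: "B (case_sum Mid Bot a) = case_sum Mid Bot (mate y a)" for a
    by (cases a) (auto simp: B_def)
  have inj1: "case_sum Top Mid a = case_sum Top Mid b \<longleftrightarrow> a = b" for a b :: "'n + 'n"
    by (cases a; cases b) auto
  have inj2: "case_sum Mid Bot a = case_sum Mid Bot b \<longleftrightarrow> a = b" for a b :: "'n + 'n"
    by (cases a; cases b) auto
  have casesA: "(\<exists>i. u = Bot i) \<or> (\<exists>a. u = case_sum Top Mid a)" for u :: "'n glue_point"
    by (cases u) (metis old.sum.simps(5), metis old.sum.simps(6), auto)
  have casesB: "(\<exists>i. u = Top i) \<or> (\<exists>a. u = case_sum Mid Bot a)" for u :: "'n glue_point"
    by (cases u) (auto, metis old.sum.simps(5), metis old.sum.simps(6))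
  have ne1: "case_sum Top Mid a \<noteq> Bot i" for a and i :: 'n by (cases a) auto
  have ne2: "case_sum Mid Bot a \<noteq> Top i" for a and i :: 'n by (cases a) auto
  have AA: "A (A u) = u" for u
    using casesA[of u] by (auto simp: A1) (simp add: A_def)
  have BB: "B (B u) = u" for u
    using casesB[of u] by (auto simp: B1) (simp add: B_def)
  have fixA: "A u = u \<longleftrightarrow> (\<exists>i. u = Bot i)" for u
    using casesA[of u] ne1 by (auto simp: A1 inj1) (simp add: A_def)
  have fixB: "B u = u \<longleftrightarrow> (\<exists>i. u = Top i)" for u
    using casesB[of u] ne2 by (auto simp: B1 inj2) (simp add: B_def)
  let ?R = "{(u, v). v = A u \<or> v = B u}"
  have "glue x y \<subseteq> ?R"
    unfolding glue_def mate by (auto simp: A1 B1)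
  moreover have "?R \<subseteq> (glue x y)\<^sup>="
  proof clarify
    fix u v assume uv: "(u, v) \<notin> glue x y" "v = A u \<or> v = B u"
    from uv(2) show "u = v"
    proof
      assume v: "v = A u"
      show ?thesis
      proof (cases "\<exists>i. u = Bot i")
        case False
        then obtain a where "u = case_sum Top Mid a" using casesA by blast
        with v uv(1) show ?thesis unfolding glue_def mate by (auto simp: A1)
      qed (use v fixA[of u] in auto)
    next
      assume v: "v = B u"
      show ?thesis
      proof (cases "\<exists>i. u = Top i")
        case False
        then obtain a where "u = case_sum Mid Bot a" using casesB by blast
        with v uv(1) show ?thesis unfolding glue_def mate by (auto simp: B1)
      qed (use v fixB[of u] in auto)
    qed
  qed
  ultimately have R: "?R\<^sup>* = (glue x y)\<^sup>*"
    using rtrancl_mono[of "glue x y" ?R] rtrancl_mono[of ?R "(glue x y)\<^sup>="] by auto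
  have R': "{(u, v). v = B u \<or> v = A u} = ?R" by blast
  let ?o = "case_sum Top Bot :: 'n + 'n \<Rightarrow> 'n glue_point"
  have "\<exists>!u. u \<noteq> ?o p \<and> (?o p, u) \<in> ?R\<^sup>* \<and> (A u = u \<or> B u = u)"
  proof (cases p)
    case (Inl i)
    show ?thesis
      by (rule alternating_path_unique_end[OF AA BB])
         (use Inl in \<open>auto simp: fixA fixB\<close>)
  next
    case (Inr i)
    have "\<exists>!u. u \<noteq> ?o p \<and> (?o p, u) \<in> {(u, v). v = B u \<or> v = A u}\<^sup>* \<and> (B u = u \<or> A u = u)"
      by (rule alternating_path_unique_end[OF BB AA])
         (use Inr in \<open>auto simp: fixA fixB\<close>)
    then show ?thesis unfolding R' by (simp only: disj_commute)
  qed
  then obtain u where u: "u \<noteq> ?o p" "(?o p, u) \<in> ?R\<^sup>*" "A u = u \<or> B u = u"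
    and u_unique: "\<And>v. v \<noteq> ?o p \<Longrightarrow> (?o p, v) \<in> ?R\<^sup>* \<Longrightarrow> A v = v \<or> B v = v \<Longrightarrow> v = u"
    by blast
  have inj3: "?o a = ?o b \<longleftrightarrow> a = b" for a b by (cases a; cases b) auto
  have outer: "A (?o a) = ?o a \<or> B (?o a) = ?o a" for a
    unfolding fixA fixB by (cases a) auto
  obtain q where q: "u = ?o q"
  proof -
    from u(3) consider i where "u = Bot i" | i where "u = Top i" unfolding fixA fixB by blast
    then show ?thesis
    proof cases
      case 1 then show ?thesis using that[of "Inr i"] by simp
    next
      case 2 then show ?thesis using that[of "Inl i"] by simp
    qed
  qed
  show ?thesis
  proof (rule ex1I[of _ q])
    show "p \<noteq> q \<and> (?o p, ?o q) \<in> (glue x y)\<^sup>*" using u q R by auto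
  next
    fix q' assume *: "p \<noteq> q' \<and> (?o p, ?o q') \<in> (glue x y)\<^sup>*"
    have "?o q' = u"
    proof (rule u_unique)
      show "?o q' \<noteq> ?o p" using * unfolding inj3 by blast
      show "(?o p, ?o q') \<in> ?R\<^sup>*" using * unfolding R by blast
    qed (rule outer)
    then show "q' = q" unfolding q inj3 .
  qed
qed

lemma sym_glue:
  fixes x y :: "'n brauer_diagram"
  shows "sym (glue x y)"
proof -
  have sw: "{p, q} \<in> E \<longleftrightarrow> {q, p} \<in> E" for p q and E :: "('n + 'n) set set"
    by (rule arg_cong[of _ _ "\<lambda>e. e \<in> E"]) (rule doubleton_eq_iff[THEN iffD2], simp)
  have "sym {(f p, f q) | p q. {p, q} \<in> E}"
    for f :: "'n + 'n \<Rightarrow> 'n glue_point" and E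
  proof (rule symI)
    fix u v assume "(u, v) \<in> {(f p, f q) | p q. {p, q} \<in> E}"
    then obtain p q where "u = f p" "v = f q" "{p, q} \<in> E" by blast
    moreover from this(3) have "{q, p} \<in> E" by (rule sw[THEN iffD1])
    ultimately show "(v, u) \<in> {(f p, f q) | p q. {p, q} \<in> E}" by blast
  qed
  then show ?thesis unfolding glue_def by (intro sym_Un)
qed

definition diagram_comp ::
    "'n brauer_diagram \<Rightarrow> 'n brauer_diagram \<Rightarrow> 'n brauer_diagram" where
  "diagram_comp x y = Brauer_diagram {{p, q} | p q. p \<noteq> q \<and>
      (case_sum Top Bot p, case_sum Top Bot q) \<in> (glue x y)\<^sup>*}"

lemma edges_diagram_comp:
  fixes x y :: "'n::finite brauer_diagram"
  shows "edges (diagram_comp x y) = {{p, q} | p q. p \<noteq> q \<and>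
      (case_sum Top Bot p, case_sum Top Bot q) \<in> (glue x y)\<^sup>*}" (is "_ = ?P")
proof -
  define c where "c = (\<lambda>p q. p \<noteq> q \<and>
      (case_sum Top Bot p, case_sum Top Bot q) \<in> (glue x y)\<^sup>*)"
  have P: "?P = {{p, q} | p q. c p q}" unfolding c_def ..
  have c_sym: "c q p" if "c p q" for p q
    using that unfolding c_def by (blast intro: symD[OF sym_rtrancl[OF sym_glue[of x y]]])
  have iff: "{p, q} \<in> ?P \<longleftrightarrow> c p q" for p q
  proof
    assume "{p, q} \<in> ?P"
    then obtain p' q' where *: "{p, q} = {p', q'}" "c p' q'" unfolding P by blast
    from *(1) show "c p q" using c_sym[OF *(2)] *(2) by (auto simp: doubleton_eq_iff)
  next
    assume "c p q" then show "{p, q} \<in> ?P" unfolding P by blast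
  qed
  have "perfect_matching ?P"
    unfolding perfect_matching_iff
  proof (intro conjI ballI allI)
    fix e assume "e \<in> ?P" then show "card e = 2" by auto
  next
    fix p show "\<exists>!q. {p, q} \<in> ?P"
      unfolding iff c_def by (rule glue_unique_end)
  qed
  then show ?thesis
    unfolding diagram_comp_def by (simp add: Brauer_diagram_inverse)
qed

section \<open>The Brauer algebra\<close>

text \<open>Elements are coefficient vectors with respect to the basis of diagrams.\<close>

type_synonym 'n brauer = "complex ^ ('n brauer_diagram)"

definition diagram_basis :: "'n brauer_diagram \<Rightarrow> 'n::finite brauer" where
  "diagram_basis x = axis x 1"

definition brauer_mult :: "complex \<Rightarrow> 'n::finite brauer \<Rightarrow> 'n brauer \<Rightarrow> 'n brauer" where
  "brauer_mult \<tau> a b =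
     (\<Sum>x\<in>UNIV. \<Sum>y\<in>UNIV. (a $ x * b $ y * \<tau> ^ loops x y) *s diagram_basis (diagram_comp x y))"

definition brauer_perm :: "'n perm \<Rightarrow> 'n::finite brauer" where
  "brauer_perm w = diagram_basis (perm_diagram w)"

definition brauer_s :: "'n \<Rightarrow> 'n \<Rightarrow> 'n::finite brauer" where
  "brauer_s i j = brauer_perm \<langle>i \<leftrightarrow> j\<rangle>"

definition brauer_e :: "'n \<Rightarrow> 'n \<Rightarrow> 'n::finite brauer" where
  "brauer_e i j = diagram_basis (e_diagram i j)"

section \<open>Connections on the configuration space\<close>

text \<open>
  Differential forms on an open subset of \<open>complex ^ 'n\<close>: a 1-form maps a point and a tangent
  vector to a value, a 2-form maps a point and two tangent vectors to a value.
\<close>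

definition config_space :: "(complex ^ 'n) set" where
  "config_space = {z. \<forall>i j. i \<noteq> j \<longrightarrow> z $ i \<noteq> z $ j}"

definition omega :: "'n \<Rightarrow> 'n \<Rightarrow> complex ^ 'n::finite \<Rightarrow> complex ^ 'n \<Rightarrow> complex" where
  "omega i j z v = frechet_derivative (\<lambda>w. w $ i - w $ j) (at z) v / (z $ i - z $ j)"

definition exterior_deriv ::
    "('a::real_normed_vector \<Rightarrow> 'a \<Rightarrow> 'b::real_normed_vector) \<Rightarrow> 'a \<Rightarrow> 'a \<Rightarrow> 'a \<Rightarrow> 'b" where
  "exterior_deriv \<Omega> z u v =
     frechet_derivative (\<lambda>w. \<Omega> w v) (at z) u - frechet_derivative (\<lambda>w. \<Omega> w u) (at z) v"

definition brauer_wedge :: "complex \<Rightarrow> ('a \<Rightarrow> 'a \<Rightarrow> 'n::finite brauer) \<Rightarrow> ('a \<Rightarrow> 'a \<Rightarrow> 'n brauer)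
    \<Rightarrow> 'a \<Rightarrow> 'a \<Rightarrow> 'a \<Rightarrow> 'n brauer" where
  "brauer_wedge \<tau> \<Omega> \<Psi> z u v = brauer_mult \<tau> (\<Omega> z u) (\<Psi> z v) - brauer_mult \<tau> (\<Omega> z v) (\<Psi> z u)"

text \<open>
  A connection on the trivial bundle with fibre the Brauer algebra is given by its algebra-valued
  connection form, acting by left multiplication.  Differentiability is required explicitly because
  \<^const>\<open>frechet_derivative\<close> is arbitrary at points where the derivative does not exist.
\<close>

definition flat_connection ::
    "complex \<Rightarrow> (complex ^ 'n \<Rightarrow> complex ^ 'n \<Rightarrow> 'n::finite brauer) \<Rightarrow> bool" where
  "flat_connection \<tau> \<Omega> \<longleftrightarrow>
     (\<forall>z\<in>config_space. \<forall>v. (\<lambda>w. \<Omega> w v) differentiable (at z)) \<and>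
     (\<forall>z\<in>config_space. \<forall>u v. exterior_deriv \<Omega> z u v - brauer_wedge \<tau> \<Omega> \<Omega> z u v = 0)"

text \<open>
  The linear order on \<open>'n\<close> only serves to list each pair \<open>i \<noteq> j\<close> once; up to renaming of the
  indices it is the order of \<open>1, \<dots>, n\<close>.
\<close>

definition connection_form :: "('n \<Rightarrow> 'n \<Rightarrow> 'n brauer)
    \<Rightarrow> complex ^ ('n::{finite,linorder}) \<Rightarrow> complex ^ ('n::{finite,linorder}) \<Rightarrow> 'n brauer" where
  "connection_form X z v = (\<Sum>(i, j)\<in>{(i, j). i < j}. omega i j z v *s X i j)"

text \<open>
  Invariance is a condition on the coefficients \<open>X i j\<close> with \<open>i \<noteq> j\<close>.  These are determined by the
  connection, since the forms \<open>omega i j\<close>, \<open>i < j\<close>, are linearly independent over the complex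
  numbers; the existential quantifier therefore involves no choice.
\<close>

definition symmetric_group_invariant :: "complex
    \<Rightarrow> (complex ^ ('n::{finite,linorder}) \<Rightarrow> complex ^ ('n::{finite,linorder}) \<Rightarrow> 'n brauer) \<Rightarrow> bool" where
  "symmetric_group_invariant \<tau> \<Omega> \<longleftrightarrow>
     (\<exists>X. (\<forall>z\<in>config_space. \<forall>v. \<Omega> z v = connection_form X z v) \<and>
          (\<forall>i j. i \<noteq> j \<longrightarrow> X j i = X i j) \<and>
          (\<forall>w i j. i \<noteq> j \<longrightarrow>
             brauer_mult \<tau> (brauer_mult \<tau> (brauer_perm w) (X i j)) (brauer_perm (inverse w)) =
             X (w \<langle>$\<rangle> i) (w \<langle>$\<rangle> j)))"

definition Omega_bar ::
    "complex \<Rightarrow> complex ^ ('n::{finite,linorder}) \<Rightarrow> complex ^ ('n::{finite,linorder}) \<Rightarrow> 'n brauer" where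
  "Omega_bar \<kappa> z v =
     \<kappa> *s (\<Sum>(i, j)\<in>{(i, j). i < j}. omega i j z v *s (brauer_s i j - brauer_e i j))"

end

theory Submission
  imports Defs
begin

text \<open>
  Put \<open>X i j = s i j - e i j\<close>.  The forms \<open>omega i j\<close> are closed, so flatness means that the commutators
  of the \<open>X i j\<close> cancel in \<open>\<Omega> \<and> \<Omega>\<close>.  By Arnold's relation this follows from the infinitesimal braid
  relations \<open>[X i j, X k l] = 0\<close> for disjoint pairs and \<open>[X i j, X i k + X j k] = 0\<close>.  In the latter,
  \<open>s i j\<close> exchanges \<open>X i k\<close> and \<open>X j k\<close>, and \<open>e i j\<close> annihilates \<open>X i k + X j k\<close> from both sides, because
  \<open>e i j e i k = e i j s j k\<close>.  None of the products involved closes a loop, so \<open>\<tau>\<close> plays no role.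
\<close>

section \<open>Products of diagrams\<close>

lemma apply_perm_inverse [simp]:
  "inverse w \<langle>$\<rangle> (w \<langle>$\<rangle> i) = i" "w \<langle>$\<rangle> (inverse w \<langle>$\<rangle> i) = i"
  by (simp_all add: apply_inverse bij_is_inj bij_is_surj surj_f_inv_f)

lemma apply_perm_eq_iff [simp]: "w \<langle>$\<rangle> i = w \<langle>$\<rangle> j \<longleftrightarrow> i = j"
  by (metis apply_perm_inverse(1))

lemma ex1_edge: "\<exists>!q. {p, q} \<in> edges (x :: 'n brauer_diagram)"
proof -
  have "perfect_matching (edges x)" using edges by auto
  then show ?thesis unfolding perfect_matching_iff by blast
qed

lemma edge_commute: "{p, q} \<in> E \<Longrightarrow> {q, p} \<in> E"
  by (simp add: insert_commute)

lemma edge_ne: "{p, q} \<in> edges (x :: 'n brauer_diagram) \<Longrightarrow> p \<noteq> q"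
proof
  assume "{p, q} \<in> edges x" "p = q"
  moreover have "perfect_matching (edges x)" using edges by auto
  ultimately show False unfolding perfect_matching_iff by force
qed

text \<open>A perfect matching is determined by the partner of each point. Equality of two products
  thus reduces to exhibiting, at every outer point, one path in each glued picture with the same
  end.\<close>

lemma diagram_eqI:
  fixes x y :: "'n brauer_diagram"
  assumes "\<And>p. \<exists>q. {p, q} \<in> edges x \<and> {p, q} \<in> edges y"
  shows "x = y"
proof -
  have "e \<in> edges b" if ab: "\<And>p. \<exists>q. {p, q} \<in> edges a \<and> {p, q} \<in> edges b" and e: "e \<in> edges a"
    for a b :: "'n brauer_diagram" and e
  proof -
    have "perfect_matching (edges a)" using edges by auto
    then have "card e = 2" using e by (auto simp: perfect_matching_def)
    then obtain p q where pq: "e = {p, q}" by (meson card_2_iff)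
    obtain q' where "{p, q'} \<in> edges a" "{p, q'} \<in> edges b" using ab by blast
    with e pq ex1_edge[of p a] show ?thesis by metis
  qed
  then have "edges x = edges y" using assms by blast
  then show ?thesis by (simp add: edges_inject)
qed

lemma connected_sym:
  "(u, v) \<in> (glue x y)\<^sup>* \<Longrightarrow> (v, u) \<in> (glue x y)\<^sup>*"
  by (meson sym_glue sym_rtrancl symD)

lemma glue_topI: "{p, q} \<in> edges x \<Longrightarrow> (case_sum Top Mid p, case_sum Top Mid q) \<in> (glue x y)\<^sup>*"
  by (rule r_into_rtrancl) (auto simp: glue_def)

lemma glue_botI: "{p, q} \<in> edges y \<Longrightarrow> (case_sum Mid Bot p, case_sum Mid Bot q) \<in> (glue x y)\<^sup>*"
  by (rule r_into_rtrancl) (auto simp: glue_def)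

lemma edges_diagram_compI:
  fixes x y :: "'n::finite brauer_diagram"
  assumes "p \<noteq> q" "(case_sum Top Bot p, case_sum Top Bot q) \<in> (glue x y)\<^sup>*"
  shows "{p, q} \<in> edges (diagram_comp x y)"
  using assms unfolding edges_diagram_comp by blast

text \<open>A loop is a component inside the middle row, so a path from each middle point to an
  outer point rules loops out.\<close>

lemma loops_eq_0:
  fixes x y :: "'n::finite brauer_diagram"
  assumes "\<And>i. \<exists>p. (Mid i, case_sum Top Bot p) \<in> (glue x y)\<^sup>*"
  shows "loops x y = 0"
proof -
  have False if C: "C \<in> UNIV // (glue x y)\<^sup>*" "C \<subseteq> range Mid" for C
  proof -
    from C(1) obtain u where u: "C = (glue x y)\<^sup>* `` {u}" by (auto simp: quotient_def)
    then have "u \<in> C" by auto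
    with C(2) obtain i where i: "u = Mid i" by auto
    obtain p where "(Mid i, case_sum Top Bot p) \<in> (glue x y)\<^sup>*" using assms by blast
    then have "case_sum Top Bot p \<in> C" using u i by auto
    with C(2) show False by (cases p) auto
  qed
  then show ?thesis unfolding loops_def by (metis (no_types, lifting) card.empty empty_Collect_eq)
qed

section \<open>Products with permutation diagrams\<close>

lemma perm_diagram_edge:
  "{Inl (w \<langle>$\<rangle> i), Inr i} \<in> edges (perm_diagram w)" "{Inr i, Inl (w \<langle>$\<rangle> i)} \<in> edges (perm_diagram w)"
proof -
  show "{Inl (w \<langle>$\<rangle> i), Inr i} \<in> edges (perm_diagram w)" by transfer blast
  then show "{Inr i, Inl (w \<langle>$\<rangle> i)} \<in> edges (perm_diagram w)" by (simp add: insert_commute)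
qed

lemma loops_perm_left:
  fixes y :: "'n::finite brauer_diagram"
  shows "loops (perm_diagram w) y = 0"
proof (rule loops_eq_0)
  fix i :: 'n
  have "(Mid i, case_sum Top Bot (Inl (w \<langle>$\<rangle> i))) \<in> (glue (perm_diagram w) y)\<^sup>*"
    using glue_topI[OF perm_diagram_edge(2), of i w y] by simp
  then show "\<exists>p. (Mid i, case_sum Top Bot p) \<in> (glue (perm_diagram w) y)\<^sup>*" by blast
qed

lemma loops_perm_right:
  fixes x :: "'n::finite brauer_diagram"
  shows "loops x (perm_diagram w) = 0"
proof (rule loops_eq_0)
  fix i :: 'n
  have "(Mid i, case_sum Top Bot (Inr (inverse w \<langle>$\<rangle> i))) \<in> (glue x (perm_diagram w))\<^sup>*"
    using glue_botI[OF perm_diagram_edge(1), of w "inverse w \<langle>$\<rangle> i" x] by simp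
  then show "\<exists>p. (Mid i, case_sum Top Bot p) \<in> (glue x (perm_diagram w))\<^sup>*" by blast
qed

text \<open>\<open>perm_diagram w\<close> joins \<open>Mid i\<close> to
  \<open>Top (w \<langle>$\<rangle> i)\<close>, so an edge of \<open>y\<close> is prolonged by one
  strand at each end that lies in the middle row.\<close>

lemma edge_perm_comp:
  fixes y :: "'n::finite brauer_diagram"
  assumes "{p, q} \<in> edges y"
  shows "{map_sum ((\<langle>$\<rangle>) w) id p, map_sum ((\<langle>$\<rangle>) w) id q} \<in> edges (diagram_comp (perm_diagram w) y)"
proof (rule edges_diagram_compI)
  show "map_sum ((\<langle>$\<rangle>) w) id p \<noteq> map_sum ((\<langle>$\<rangle>) w) id q"
    using edge_ne[OF assms] by (cases p; cases q) auto
  have *: "(case_sum Top Bot (map_sum ((\<langle>$\<rangle>) w) id r), case_sum Mid Bot r) \<in> (glue (perm_diagram w) y)\<^sup>*" for r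
    using glue_topI[OF perm_diagram_edge(1), of w _ y] by (cases r) auto
  show "(case_sum Top Bot (map_sum ((\<langle>$\<rangle>) w) id p), case_sum Top Bot (map_sum ((\<langle>$\<rangle>) w) id q))
      \<in> (glue (perm_diagram w) y)\<^sup>*"
    using *[of p] glue_botI[OF assms, of "perm_diagram w"] connected_sym[OF *[of q]] by (meson rtrancl_trans)
qed

text \<open>The inverse appears because the strand of \<open>perm_diagram w\<close> that starts at
  the middle point \<open>i\<close> ends at the bottom point
  \<open>inverse w \<langle>$\<rangle> i\<close>.\<close>

lemma edge_comp_perm:
  fixes x :: "'n::finite brauer_diagram"
  assumes "{p, q} \<in> edges x"
  shows "{map_sum id ((\<langle>$\<rangle>) (inverse w)) p, map_sum id ((\<langle>$\<rangle>) (inverse w)) q}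
    \<in> edges (diagram_comp x (perm_diagram w))"
proof (rule edges_diagram_compI)
  show "map_sum id ((\<langle>$\<rangle>) (inverse w)) p \<noteq> map_sum id ((\<langle>$\<rangle>) (inverse w)) q"
    using edge_ne[OF assms] by (cases p; cases q) auto
  have *: "(case_sum Top Bot (map_sum id ((\<langle>$\<rangle>) (inverse w)) r), case_sum Top Mid r)
      \<in> (glue x (perm_diagram w))\<^sup>*" for r
    using glue_botI[OF perm_diagram_edge(2), of "inverse w \<langle>$\<rangle> _" w x] by (cases r) auto
  show "(case_sum Top Bot (map_sum id ((\<langle>$\<rangle>) (inverse w)) p),
      case_sum Top Bot (map_sum id ((\<langle>$\<rangle>) (inverse w)) q)) \<in> (glue x (perm_diagram w))\<^sup>*"
    using *[of p] glue_topI[OF assms, of "perm_diagram w"] connected_sym[OF *[of q]] by (meson rtrancl_trans)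
qed

lemma e_diagram_edge:
  assumes "i \<noteq> j"
  shows "{Inl i, Inl j} \<in> edges (e_diagram i j)" "{Inr i, Inr j} \<in> edges (e_diagram i j)"
    "{Inl j, Inl i} \<in> edges (e_diagram i j)" "{Inr j, Inr i} \<in> edges (e_diagram i j)"
    "\<And>k. k \<noteq> i \<Longrightarrow> k \<noteq> j \<Longrightarrow> {Inl k, Inr k} \<in> edges (e_diagram i j)"
    "\<And>k. k \<noteq> i \<Longrightarrow> k \<noteq> j \<Longrightarrow> {Inr k, Inl k} \<in> edges (e_diagram i j)"
  using assms by (transfer; auto simp: insert_commute)+

lemma e_diagram_same: "e_diagram i i = perm_diagram 1"
  by transfer auto

lemma e_diagram_commute: "e_diagram i j = e_diagram j i"
  by transfer (auto simp: insert_commute)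

lemma perm_diagram_comp:
  "diagram_comp (perm_diagram v) (perm_diagram w) = (perm_diagram (v * w) :: 'n::finite brauer_diagram)"
proof (rule diagram_eqI)
  fix p :: "'n + 'n"
  show "\<exists>q. {p, q} \<in> edges (diagram_comp (perm_diagram v) (perm_diagram w))
      \<and> {p, q} \<in> edges (perm_diagram (v * w))"
  proof (cases p)
    case (Inl a)
    let ?i = "inverse (v * w) \<langle>$\<rangle> a"
    have "(v * w) \<langle>$\<rangle> ?i = a" by (rule apply_perm_inverse)
    with Inl edge_perm_comp[OF perm_diagram_edge(1), of v w ?i] perm_diagram_edge(1)[of "v * w" ?i]
    show ?thesis by (intro exI[of _ "Inr ?i"]) (simp add: apply_times)
  next
    case (Inr i)
    with edge_perm_comp[OF perm_diagram_edge(2), of v i w] perm_diagram_edge(2)[of i "v * w"]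
    show ?thesis by (intro exI[of _ "Inl ((v * w) \<langle>$\<rangle> i)"]) (simp add: apply_times)
  qed
qed

lemma diagram_comp_1_right [simp]: "diagram_comp x (perm_diagram 1) = (x :: 'n::finite brauer_diagram)"
proof (rule diagram_eqI)
  fix p
  obtain q where "{p, q} \<in> edges x" using ex1_edge by blast
  moreover from edge_comp_perm[OF this, of 1] have "{p, q} \<in> edges (diagram_comp x (perm_diagram 1))"
    by (cases p; cases q) auto
  ultimately show "\<exists>q. {p, q} \<in> edges (diagram_comp x (perm_diagram 1)) \<and> {p, q} \<in> edges x" by blast
qed

text \<open>This instance of associativity turns the exchange relation \<open>perm_e_diagram\<close>
  into a statement about conjugation by \<open>w\<close>. Both sides relabel the bottom points of
  \<open>x\<close> in the same way.\<close>

lemma diagram_comp_perm_perm: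
  "diagram_comp (diagram_comp x (perm_diagram v)) (perm_diagram w) = (diagram_comp x (perm_diagram (v * w)) :: 'n::finite brauer_diagram)"
proof (rule diagram_eqI)
  fix p
  let ?f = "\<lambda>w. map_sum id ((\<langle>$\<rangle>) (inverse w)) :: 'n + 'n \<Rightarrow> 'n + 'n"
  have f: "?f (v * w) r = ?f w (?f v r)" for r by (cases r) (simp_all add: apply_times)
  have "?f (v * w) (map_sum id ((\<langle>$\<rangle>) (v * w)) p) = p" by (cases p) (simp_all del: perm.inverse_distrib_swap)
  then obtain r where r: "p = ?f (v * w) r" by metis
  obtain q where q: "{r, q} \<in> edges x" using ex1_edge by blast
  show "\<exists>q. {p, q} \<in> edges (diagram_comp (diagram_comp x (perm_diagram v)) (perm_diagram w))
      \<and> {p, q} \<in> edges (diagram_comp x (perm_diagram (v * w)))"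
    using edge_comp_perm[OF q, of "v * w"] edge_comp_perm[OF edge_comp_perm[OF q, of v], of w]
    unfolding f[symmetric] r by blast
qed

lemma perm_swap: "w * \<langle>i \<leftrightarrow> j\<rangle> = \<langle>w \<langle>$\<rangle> i \<leftrightarrow> w \<langle>$\<rangle> j\<rangle> * w"
proof (rule perm_eqI)
  fix a
  show "(w * \<langle>i \<leftrightarrow> j\<rangle>) \<langle>$\<rangle> a = (\<langle>w \<langle>$\<rangle> i \<leftrightarrow> w \<langle>$\<rangle> j\<rangle> * w) \<langle>$\<rangle> a"
    by (cases "a = i"; cases "a = j") (auto simp: apply_times)
qed

text \<open>As an exchange relation, each side is a single product with a permutation diagram. Both
  sides have the top arc from \<open>w i\<close> to \<open>w j\<close>, the bottom arc from
  \<open>i\<close> to \<open>j\<close>, and strands from top \<open>w k\<close> to bottom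
  \<open>k\<close>.\<close>

lemma perm_e_diagram:
  fixes i j :: "'n::finite"
  shows "diagram_comp (perm_diagram w) (e_diagram i j)
    = diagram_comp (e_diagram (w \<langle>$\<rangle> i) (w \<langle>$\<rangle> j)) (perm_diagram w)"
proof (cases "i = j")
  \<comment> \<open>Here \<open>e_diagram\<close> takes its default value, the identity
    diagram.\<close>
  case True
  then show ?thesis by (simp add: e_diagram_same perm_diagram_comp)
next
  case False
  then have wF: "w \<langle>$\<rangle> i \<noteq> w \<langle>$\<rangle> j" by simp
  show ?thesis
  proof (rule diagram_eqI)
    fix p :: "'n + 'n"
    note L = e_diagram_edge[OF False, THEN edge_perm_comp[where w = w]]
    note R = e_diagram_edge[OF wF, THEN edge_comp_perm[where w = w]]
    consider k where "p = Inl (w \<langle>$\<rangle> k)" | k where "p = Inr k"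
      by (metis apply_perm_inverse(2) sum.exhaust)
    then show "\<exists>q. {p, q} \<in> edges (diagram_comp (perm_diagram w) (e_diagram i j))
        \<and> {p, q} \<in> edges (diagram_comp (e_diagram (w \<langle>$\<rangle> i) (w \<langle>$\<rangle> j)) (perm_diagram w))"
    proof cases
      case 1
      then show ?thesis
        using False L(1,3) R(1,3) L(5)[of k] R(5)[of "w \<langle>$\<rangle> k"]
        by (cases "k = i"; cases "k = j") auto
    next
      case 2
      then show ?thesis
        using False L(2,4) R(2,4) L(6)[of k] R(6)[of "w \<langle>$\<rangle> k"]
        by (cases "k = i"; cases "k = j") auto
    qed
  qed
qed

section \<open>Products of two diagrams of type \<open>e\<close>\<close>

context
  fixes i j k :: "'n::finite"
  assumes ne: "i \<noteq> j" "i \<noteq> k" "j \<noteq> k"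
begin

text \<open>In the middle row the arcs \<open>i j\<close> and \<open>i k\<close> form a path from
  \<open>j\<close> through \<open>i\<close> to \<open>k\<close>, which escapes to the top along
  strand \<open>k\<close>. Every other middle point has its own strand to the top.\<close>

lemma loops_e_e_adjacent: "loops (e_diagram i j) (e_diagram i k) = 0"
proof (rule loops_eq_0)
  fix m
  note T = e_diagram_edge[OF ne(1), THEN glue_topI[where y = "e_diagram i k"]]
  note B = e_diagram_edge[OF ne(2), THEN glue_botI[where x = "e_diagram i j"]]
  have k: "(Mid k, Top k) \<in> (glue (e_diagram i j) (e_diagram i k))\<^sup>*"
    using T(6)[of k] ne by simp
  have i: "(Mid i, Top k) \<in> (glue (e_diagram i j) (e_diagram i k))\<^sup>*"
    using B(1) k by (auto intro: rtrancl_trans)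
  have j: "(Mid j, Top k) \<in> (glue (e_diagram i j) (e_diagram i k))\<^sup>*"
    using T(4) i by (auto intro: rtrancl_trans)
  have "\<exists>n. (Mid m, Top n) \<in> (glue (e_diagram i j) (e_diagram i k))\<^sup>*"
    using i j T(6)[of m] by (cases "m = i"; cases "m = j") auto
  then show "\<exists>p. (Mid m, case_sum Top Bot p) \<in> (glue (e_diagram i j) (e_diagram i k))\<^sup>*"
    by (metis old.sum.simps(5))
qed

lemma e_e_adjacent:
  "diagram_comp (e_diagram i j) (e_diagram i k) = diagram_comp (e_diagram i j) (perm_diagram \<langle>j \<leftrightarrow> k\<rangle>)"
proof (rule diagram_eqI)
  let ?G = "(glue (e_diagram i j) (e_diagram i k))\<^sup>*"
  let ?E = "edges (diagram_comp (e_diagram i j) (e_diagram i k))"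
  let ?F = "edges (diagram_comp (e_diagram i j) (perm_diagram \<langle>j \<leftrightarrow> k\<rangle>))"
  note T = e_diagram_edge[OF ne(1), THEN glue_topI[where y = "e_diagram i k"]]
  note B = e_diagram_edge[OF ne(2), THEN glue_botI[where x = "e_diagram i j"]]
  note R = e_diagram_edge[OF ne(1), THEN edge_comp_perm[where w = "\<langle>j \<leftrightarrow> k\<rangle>"]]
  \<comment> \<open>The only strand that is not vertical: it descends at \<open>k\<close>, runs
    through both middle arcs, and leaves at the bottom point \<open>j\<close>.\<close>
  have "(Top k, Mid k) \<in> ?G" "(Mid k, Mid i) \<in> ?G" "(Mid i, Mid j) \<in> ?G" "(Mid j, Bot j) \<in> ?G"
    using T(2) T(5)[of k] B(3) B(5)[of j] ne by auto
  then have kj: "(Top k, Bot j) \<in> ?G" by (meson rtrancl_trans)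
  have E1: "{Inl i, Inl j} \<in> ?E" "{Inr i, Inr k} \<in> ?E" "{Inl k, Inr j} \<in> ?E"
    using T(1) B(2) kj ne by (auto intro!: edges_diagram_compI)
  have E2: "{Inl m, Inr m} \<in> ?E" if "m \<noteq> i" "m \<noteq> j" "m \<noteq> k" for m
    using T(5)[of m] B(5)[of m] that by (auto intro!: edges_diagram_compI intro: rtrancl_trans)
  have F1: "{Inl i, Inl j} \<in> ?F" "{Inr i, Inr k} \<in> ?F" "{Inl k, Inr j} \<in> ?F"
    using R(1,2) R(5)[of k] ne by auto
  have F2: "{Inl m, Inr m} \<in> ?F" if "m \<noteq> i" "m \<noteq> j" "m \<noteq> k" for m
    using R(5)[of m] that by simp
  fix p
  consider "p \<in> {Inl i, Inl j, Inr i, Inr k, Inl k, Inr j}"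
    | m where "p \<in> {Inl m, Inr m}" "m \<noteq> i" "m \<noteq> j" "m \<noteq> k"
    by (cases p) auto
  then show "\<exists>q. {p, q} \<in> ?E \<and> {p, q} \<in> ?F"
  proof cases
    case 1
    then show ?thesis using E1 F1 E1[THEN edge_commute] F1[THEN edge_commute] by blast
  next
    case 2
    then show ?thesis using E2[of m] F2[of m] E2[of m, THEN edge_commute] F2[of m, THEN edge_commute] by blast
  qed
qed

end

context
  fixes i j k l :: "'n::finite"
  assumes ne: "i \<noteq> j" "k \<noteq> l" "{i, j} \<inter> {k, l} = {}"
begin

text \<open>A middle point outside \<open>{i, j}\<close> has a strand to the top, one outside
  \<open>{k, l}\<close> a strand to the bottom. Disjointness leaves no other middle points.\<close>

lemma loops_e_e_disjoint: "loops (e_diagram i j) (e_diagram k l) = 0"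
proof (rule loops_eq_0)
  fix m
  note T = e_diagram_edge[OF ne(1), THEN glue_topI[where y = "e_diagram k l"]]
  note B = e_diagram_edge[OF ne(2), THEN glue_botI[where x = "e_diagram i j"]]
  have "(Mid m, Top m) \<in> (glue (e_diagram i j) (e_diagram k l))\<^sup>* \<or>
      (Mid m, Bot m) \<in> (glue (e_diagram i j) (e_diagram k l))\<^sup>*"
    using T(6)[of m] B(5)[of m] ne by auto
  then show "\<exists>p. (Mid m, case_sum Top Bot p) \<in> (glue (e_diagram i j) (e_diagram k l))\<^sup>*"
    by (metis old.sum.simps(5,6))
qed

text \<open>The list is symmetric under exchanging the pairs \<open>i j\<close> and
  \<open>k l\<close>, which gives commutation of the two diagrams.\<close>

lemma e_e_disjoint_edges:
  shows "{Inl i, Inl j} \<in> edges (diagram_comp (e_diagram i j) (e_diagram k l))"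
    "{Inl k, Inl l} \<in> edges (diagram_comp (e_diagram i j) (e_diagram k l))"
    "{Inr i, Inr j} \<in> edges (diagram_comp (e_diagram i j) (e_diagram k l))"
    "{Inr k, Inr l} \<in> edges (diagram_comp (e_diagram i j) (e_diagram k l))"
    "m \<notin> {i, j, k, l} \<Longrightarrow> {Inl m, Inr m} \<in> edges (diagram_comp (e_diagram i j) (e_diagram k l))"
proof -
  let ?G = "(glue (e_diagram i j) (e_diagram k l))\<^sup>*"
  note T = e_diagram_edge[OF ne(1), THEN glue_topI[where y = "e_diagram k l"]]
  note B = e_diagram_edge[OF ne(2), THEN glue_botI[where x = "e_diagram i j"]]
  \<comment> \<open>The top arc of the lower diagram is carried up along two vertical strands of the
    upper one; dually, the bottom arc of the upper diagram is carried down.\<close>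
  have "(Top k, Mid k) \<in> ?G" "(Mid k, Mid l) \<in> ?G" "(Mid l, Top l) \<in> ?G"
    using T(5)[of k] T(6)[of l] B(1) ne by auto
  then have kl: "(Top k, Top l) \<in> ?G" by (meson rtrancl_trans)
  have "(Bot i, Mid i) \<in> ?G" "(Mid i, Mid j) \<in> ?G" "(Mid j, Bot j) \<in> ?G"
    using B(6)[of i] B(5)[of j] T(2) ne by auto
  then have ij: "(Bot i, Bot j) \<in> ?G" by (meson rtrancl_trans)
  show "{Inl i, Inl j} \<in> edges (diagram_comp (e_diagram i j) (e_diagram k l))"
    "{Inl k, Inl l} \<in> edges (diagram_comp (e_diagram i j) (e_diagram k l))"
    "{Inr i, Inr j} \<in> edges (diagram_comp (e_diagram i j) (e_diagram k l))"
    "{Inr k, Inr l} \<in> edges (diagram_comp (e_diagram i j) (e_diagram k l))"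
    using kl ij T(1) B(2) ne by (auto intro!: edges_diagram_compI)
  show "m \<notin> {i, j, k, l} \<Longrightarrow> {Inl m, Inr m} \<in> edges (diagram_comp (e_diagram i j) (e_diagram k l))"
    using T(5)[of m] B(5)[of m] by (auto intro!: edges_diagram_compI intro: rtrancl_trans)
qed

end

lemma e_e_disjoint:
  fixes i j k l :: "'n::finite"
  assumes "i \<noteq> j" "k \<noteq> l" "{i, j} \<inter> {k, l} = {}"
  shows "diagram_comp (e_diagram i j) (e_diagram k l) = diagram_comp (e_diagram k l) (e_diagram i j)"
    (is "?x = ?y")
proof (rule diagram_eqI)
  have sym: "{k, l} \<inter> {i, j} = {}" using assms by blast
  note E = e_e_disjoint_edges[OF assms] and F = e_e_disjoint_edges[OF assms(2,1) sym]
  fix p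
  consider "p \<in> {Inl i, Inl j, Inr i, Inr j, Inl k, Inl l, Inr k, Inr l}"
    | m where "p \<in> {Inl m, Inr m}" "m \<notin> {i, j, k, l}" "m \<notin> {k, l, i, j}"
    by (cases p) auto
  then show "\<exists>q. {p, q} \<in> edges ?x \<and> {p, q} \<in> edges ?y"
  proof cases
    case 1
    then show ?thesis
      using E(1-4) F(1-4) E(1-4)[THEN edge_commute] F(1-4)[THEN edge_commute] by blast
  next
    case 2
    then show ?thesis
      using E(5)[of m] F(5)[of m] E(5)[of m, THEN edge_commute] F(5)[of m, THEN edge_commute] by blast
  qed
qed

section \<open>Commutators in the Brauer algebra\<close>

lemma linear_brauer_mult_left: "Vector_Spaces.linear (*s) (*s) (\<lambda>a. brauer_mult \<tau> a b)"
  by unfold_locales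
    (simp_all add: brauer_mult_def algebra_simps sum.distrib vec.scale_sum_right vec.scale_left_distrib)

lemma linear_brauer_mult_right: "Vector_Spaces.linear (*s) (*s) (brauer_mult \<tau> a)"
  by unfold_locales
    (simp_all add: brauer_mult_def algebra_simps sum.distrib vec.scale_sum_right vec.scale_left_distrib)

text \<open>The third component of the locale \<open>Vector_Spaces.linear\<close> is
  \<open>module_hom\<close>, which supplies the rules for all linear operations at once.\<close>

lemmas brauer_mult_add_left = linear_brauer_mult_left[THEN Vector_Spaces.linear.axioms(3), THEN module_hom.add]
  and brauer_mult_diff_left = linear_brauer_mult_left[THEN Vector_Spaces.linear.axioms(3), THEN module_hom.diff]
  and brauer_mult_scale_left = linear_brauer_mult_left[THEN Vector_Spaces.linear.axioms(3), THEN module_hom.scale]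
  and brauer_mult_sum_left = linear_brauer_mult_left[THEN Vector_Spaces.linear.axioms(3), THEN module_hom.sum]
  and brauer_mult_add_right = linear_brauer_mult_right[THEN Vector_Spaces.linear.axioms(3), THEN module_hom.add]
  and brauer_mult_diff_right = linear_brauer_mult_right[THEN Vector_Spaces.linear.axioms(3), THEN module_hom.diff]
  and brauer_mult_scale_right = linear_brauer_mult_right[THEN Vector_Spaces.linear.axioms(3), THEN module_hom.scale]
  and brauer_mult_sum_right = linear_brauer_mult_right[THEN Vector_Spaces.linear.axioms(3), THEN module_hom.sum]

text \<open>The condition involves only the outer index, so the usual delta rule applies once the
  sums are exchanged.\<close>

lemma sum_delta_outer:
  fixes F :: "'a::finite \<Rightarrow> 'b::finite \<Rightarrow> 'c::comm_monoid_add"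
  shows "(\<Sum>k\<in>UNIV. \<Sum>l\<in>UNIV. if i = k then F k l else 0) = (\<Sum>l\<in>UNIV. F i l)"
  by (subst sum.swap) simp

lemma brauer_mult_basis:
  "brauer_mult \<tau> (diagram_basis x) (diagram_basis y) = \<tau> ^ loops x y *s diagram_basis (diagram_comp x y)"
proof -
  have "(diagram_basis x $ x' * diagram_basis y $ y' * \<tau> ^ loops x' y') *s diagram_basis (diagram_comp x' y')
     = (if x = x' then if y = y' then \<tau> ^ loops x y *s diagram_basis (diagram_comp x y) else 0 else 0)" for x' y'
    by (auto simp: diagram_basis_def axis_def)
  then show ?thesis
    unfolding brauer_mult_def by (simp add: sum_delta_outer)
qed

text \<open>The wedge square of a connection form, evaluated at two tangent vectors, is the
  commutator of the two values of the form.\<close>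

definition brauer_comm :: "complex \<Rightarrow> 'n::finite brauer \<Rightarrow> 'n brauer \<Rightarrow> 'n brauer" where
  "brauer_comm \<tau> a b = brauer_mult \<tau> a b - brauer_mult \<tau> b a"

lemma brauer_comm_self [simp]: "brauer_comm \<tau> a a = 0"
  by (simp add: brauer_comm_def)

lemma brauer_comm_swap: "brauer_comm \<tau> a b = - brauer_comm \<tau> b a"
  by (simp add: brauer_comm_def)

lemma brauer_comm_add_right: "brauer_comm \<tau> a (b + c) = brauer_comm \<tau> a b + brauer_comm \<tau> a c"
  by (simp add: brauer_comm_def brauer_mult_add_left brauer_mult_add_right)

lemma brauer_comm_scale_left: "brauer_comm \<tau> (c *s a) b = c *s brauer_comm \<tau> a b"
  by (simp add: brauer_comm_def brauer_mult_scale_left brauer_mult_scale_right vec.scale_right_diff_distrib)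

lemma brauer_comm_scale_right: "brauer_comm \<tau> a (c *s b) = c *s brauer_comm \<tau> a b"
  by (simp add: brauer_comm_def brauer_mult_scale_left brauer_mult_scale_right vec.scale_right_diff_distrib)

lemma brauer_comm_sum_left: "brauer_comm \<tau> (sum f A) b = (\<Sum>x\<in>A. brauer_comm \<tau> (f x) b)"
  by (simp add: brauer_comm_def brauer_mult_sum_left brauer_mult_sum_right sum_subtractf)

lemma brauer_comm_sum_right: "brauer_comm \<tau> b (sum f A) = (\<Sum>x\<in>A. brauer_comm \<tau> b (f x))"
  by (simp add: brauer_comm_def brauer_mult_sum_left brauer_mult_sum_right sum_subtractf)

lemma brauer_comm_0 [simp]: "brauer_comm \<tau> 0 b = 0" "brauer_comm \<tau> b 0 = 0"
  using brauer_comm_scale_left[of \<tau> 0 0 b] brauer_comm_scale_right[of \<tau> b 0 0] by simp_all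

section \<open>The infinitesimal braid relations\<close>

lemma brauer_basis_mult:
  "brauer_mult \<tau> (brauer_perm w) (diagram_basis x) = diagram_basis (diagram_comp (perm_diagram w) x)"
  "brauer_mult \<tau> (diagram_basis x) (brauer_perm w) = diagram_basis (diagram_comp x (perm_diagram w))"
  by (simp_all add: brauer_perm_def brauer_mult_basis loops_perm_left loops_perm_right)

lemma brauer_perm_mult: "brauer_mult \<tau> (brauer_perm v) (brauer_perm w) = brauer_perm (v * w)"
  unfolding brauer_perm_def[of w] brauer_basis_mult perm_diagram_comp by (simp add: brauer_perm_def)

lemma brauer_perm_s: "brauer_mult \<tau> (brauer_perm w) (brauer_s i j)
    = brauer_mult \<tau> (brauer_s (w \<langle>$\<rangle> i) (w \<langle>$\<rangle> j)) (brauer_perm w)"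
  unfolding brauer_s_def brauer_perm_mult perm_swap ..

lemma brauer_perm_e: "brauer_mult \<tau> (brauer_perm w) (brauer_e i j)
    = brauer_mult \<tau> (brauer_e (w \<langle>$\<rangle> i) (w \<langle>$\<rangle> j)) (brauer_perm w)"
  unfolding brauer_e_def brauer_basis_mult perm_e_diagram ..

lemma brauer_conj_s: "brauer_mult \<tau> (brauer_mult \<tau> (brauer_perm w) (brauer_s i j)) (brauer_perm (inverse w))
    = brauer_s (w \<langle>$\<rangle> i) (w \<langle>$\<rangle> j)"
  unfolding brauer_s_def brauer_perm_mult perm_swap by (simp add: mult.assoc)

lemma brauer_conj_e: "brauer_mult \<tau> (brauer_mult \<tau> (brauer_perm w) (brauer_e i j)) (brauer_perm (inverse w))
    = brauer_e (w \<langle>$\<rangle> i) (w \<langle>$\<rangle> j)"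
  unfolding brauer_e_def brauer_basis_mult perm_e_diagram diagram_comp_perm_perm by simp

definition brauer_X :: "'n \<Rightarrow> 'n \<Rightarrow> 'n::finite brauer" where
  "brauer_X i j = brauer_s i j - brauer_e i j"

lemma brauer_X_commute: "brauer_X j i = brauer_X i j"
  unfolding brauer_X_def brauer_s_def brauer_e_def by (simp add: swap_sym[of i] e_diagram_commute[of i])

text \<open>Both terms degenerate to the identity: the transposition of \<open>i\<close> with
  itself, and the default value of \<open>e_diagram\<close>.\<close>

lemma brauer_X_same: "brauer_X i i = 0"
  by (simp add: brauer_X_def brauer_s_def brauer_e_def brauer_perm_def e_diagram_same)

lemma brauer_X_conj: "brauer_mult \<tau> (brauer_mult \<tau> (brauer_perm w) (brauer_X i j)) (brauer_perm (inverse w))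
    = brauer_X (w \<langle>$\<rangle> i) (w \<langle>$\<rangle> j)"
  by (simp add: brauer_X_def brauer_mult_diff_left brauer_mult_diff_right brauer_conj_s brauer_conj_e)

lemma brauer_s_X: "brauer_mult \<tau> (brauer_s i j) (brauer_X k l) =
    brauer_mult \<tau> (brauer_X (\<langle>i \<leftrightarrow> j\<rangle> \<langle>$\<rangle> k) (\<langle>i \<leftrightarrow> j\<rangle> \<langle>$\<rangle> l)) (brauer_s i j)"
  unfolding brauer_X_def brauer_mult_diff_left brauer_mult_diff_right brauer_s_def[of i j] brauer_perm_s brauer_perm_e ..

lemma brauer_e_e_adjacent:
  assumes "i \<noteq> j" "i \<noteq> k" "j \<noteq> k"
  shows "brauer_mult \<tau> (brauer_e i j) (brauer_e i k) = brauer_mult \<tau> (brauer_e i j) (brauer_s j k)"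
  unfolding brauer_e_def brauer_s_def brauer_basis_mult brauer_mult_basis
  using assms by (simp add: loops_e_e_adjacent e_e_adjacent)

lemma brauer_e_commute: "brauer_e j i = brauer_e i j"
  unfolding brauer_e_def by (simp add: e_diagram_commute)

lemma brauer_s_commute: "brauer_s j i = brauer_s i j"
  unfolding brauer_s_def by (simp add: swap_sym)

text \<open>A transposition commutes with every element whose indices it fixes; the one remaining
  pair of factors, \<open>e i j\<close> and \<open>e k l\<close>, commutes by the diagram
  computation.\<close>

lemma brauer_X_disjoint:
  assumes "i \<noteq> j" "k \<noteq> l" "{i, j} \<inter> {k, l} = {}"
  shows "brauer_comm \<tau> (brauer_X i j) (brauer_X k l) = 0"
proof -
  have kl: "\<langle>i \<leftrightarrow> j\<rangle> \<langle>$\<rangle> k = k" "\<langle>i \<leftrightarrow> j\<rangle> \<langle>$\<rangle> l = l" "\<langle>k \<leftrightarrow> l\<rangle> \<langle>$\<rangle> i = i" "\<langle>k \<leftrightarrow> l\<rangle> \<langle>$\<rangle> j = j"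
    using assms by auto
  have ee: "brauer_mult \<tau> (brauer_e i j) (brauer_e k l) = brauer_mult \<tau> (brauer_e k l) (brauer_e i j)"
    unfolding brauer_e_def brauer_mult_basis
    using assms loops_e_e_disjoint[of i j k l] loops_e_e_disjoint[of k l i j] by (auto simp: e_e_disjoint Int_commute)
  have "brauer_mult \<tau> (brauer_s i j) (brauer_X k l) = brauer_mult \<tau> (brauer_X k l) (brauer_s i j)"
    unfolding brauer_s_X kl ..
  moreover have "brauer_mult \<tau> (brauer_s k l) (brauer_e i j) = brauer_mult \<tau> (brauer_e i j) (brauer_s k l)"
    unfolding brauer_s_def brauer_perm_e kl ..
  ultimately show ?thesis
    using ee unfolding brauer_comm_def
    by (simp add: brauer_X_def brauer_mult_diff_left brauer_mult_diff_right algebra_simps)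
qed

lemma brauer_X_four_term:
  assumes "i \<noteq> j" "i \<noteq> k" "j \<noteq> k"
  shows "brauer_comm \<tau> (brauer_X i j) (brauer_X i k + brauer_X j k) = 0"
proof -
  have s: "\<langle>i \<leftrightarrow> j\<rangle> \<langle>$\<rangle> k = k" "\<langle>j \<leftrightarrow> k\<rangle> \<langle>$\<rangle> i = i" "\<langle>i \<leftrightarrow> k\<rangle> \<langle>$\<rangle> j = j" using assms by auto
  have "brauer_mult \<tau> (brauer_s i j) (brauer_X i k) = brauer_mult \<tau> (brauer_X j k) (brauer_s i j)"
    "brauer_mult \<tau> (brauer_s i j) (brauer_X j k) = brauer_mult \<tau> (brauer_X i k) (brauer_s i j)"
    unfolding brauer_s_X by (simp_all add: s)
  \<comment> \<open>Since \<open>e i j e i k = e i j s j k\<close> and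
    \<open>e i j e j k = e i j s i k\<close>, the four products cancel crosswise.\<close>
  moreover have "brauer_mult \<tau> (brauer_e i j) (brauer_X i k + brauer_X j k) = 0"
    using brauer_e_e_adjacent[of i j k \<tau>] brauer_e_e_adjacent[of j i k \<tau>] assms
    by (simp add: brauer_X_def brauer_mult_diff_left brauer_mult_diff_right brauer_mult_add_right
      brauer_e_commute[of i j])
  \<comment> \<open>Moving the transpositions to the right gives \<open>e j k s i k\<close> and
    \<open>e i k s j k\<close>; these are also the values of \<open>e j k e i j\<close> and
    \<open>e i k e i j\<close>, so the terms again cancel crosswise.\<close>
  moreover have "brauer_mult \<tau> (brauer_X i k + brauer_X j k) (brauer_e i j) = 0"
  proof -
    have "brauer_mult \<tau> (brauer_s i k) (brauer_e i j) = brauer_mult \<tau> (brauer_e j k) (brauer_s i k)"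
      "brauer_mult \<tau> (brauer_s j k) (brauer_e i j) = brauer_mult \<tau> (brauer_e i k) (brauer_s j k)"
      unfolding brauer_s_def brauer_perm_e by (simp_all add: s brauer_e_commute)
    with brauer_e_e_adjacent[of i k j \<tau>] brauer_e_e_adjacent[of j k i \<tau>] assms show ?thesis
      by (simp add: brauer_X_def brauer_mult_diff_left brauer_mult_diff_right brauer_mult_add_left
        brauer_e_commute[of i j] brauer_s_commute)
  qed
  ultimately show ?thesis
    unfolding brauer_comm_def brauer_X_def[of i j] brauer_mult_diff_left brauer_mult_diff_right
    by (simp add: brauer_mult_add_left brauer_mult_add_right)
qed

section \<open>Flatness\<close>

lemma omega_eq: "omega i j z v = (v $ i - v $ j) / (z $ i - z $ j)"
proof -
  have "((\<lambda>w. w $ i - w $ j) has_derivative (\<lambda>w. w $ i - w $ j)) (at z)"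
    by (intro bounded_linear_imp_has_derivative bounded_linear_sub bounded_linear_vec_nth)
  then have "frechet_derivative (\<lambda>w. w $ i - w $ j) (at z) = (\<lambda>w. w $ i - w $ j)"
    by (rule frechet_derivative_at[symmetric])
  then show ?thesis by (simp add: omega_def)
qed

lemma has_derivative_omega:
  fixes z v :: "complex ^ 'n::finite"
  assumes "z $ i \<noteq> z $ j"
  shows "((\<lambda>w. omega i j w v) has_derivative
    (\<lambda>u. - ((v $ i - v $ j) * (u $ i - u $ j) / (z $ i - z $ j)\<^sup>2))) (at z)"
proof -
  have *: "((\<lambda>w. w $ i - w $ j) has_derivative (\<lambda>w. w $ i - w $ j)) (at z)"
    by (intro bounded_linear_imp_has_derivative bounded_linear_sub bounded_linear_vec_nth)
  show ?thesis
    unfolding omega_eq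
    by (rule has_derivative_eq_rhs, rule has_derivative_divide[OF has_derivative_const *])
      (use assms in \<open>simp_all add: fun_eq_iff power2_eq_square divide_inverse mult_ac del: minus_diff_eq\<close>)
qed

lemma bounded_linear_vector_scale_left:
  "bounded_linear (\<lambda>c::complex. c *s (x :: complex ^ 'm::finite))"
  unfolding linear_conv_bounded_linear[symmetric]
  by (rule linearI) (simp_all add: vec.scale_left_distrib vec_eq_iff)

lemma has_derivative_connection_form:
  fixes z v :: "complex ^ 'n::{finite,linorder}"
  assumes "z \<in> config_space"
  shows "((\<lambda>w. connection_form X w v) has_derivative
    (\<lambda>u. \<Sum>(i, j)\<in>{(i, j). i < j}.
        - ((v $ i - v $ j) * (u $ i - u $ j) / (z $ i - z $ j)\<^sup>2) *s X i j)) (at z)"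
  unfolding connection_form_def
proof (rule has_derivative_sum, clarify)
  fix i j :: 'n assume "i < j"
  then have "z $ i \<noteq> z $ j" using assms by (auto simp: config_space_def)
  then show "((\<lambda>w. omega i j w v *s X i j) has_derivative
     (\<lambda>u. - ((v $ i - v $ j) * (u $ i - u $ j) / (z $ i - z $ j)\<^sup>2) *s X i j)) (at z)"
    by (intro bounded_linear.has_derivative[OF bounded_linear_vector_scale_left] has_derivative_omega)
qed

text \<open>The derivative of the form at \<open>v\<close> in direction \<open>u\<close> is
  symmetric in \<open>u\<close> and \<open>v\<close>, so its antisymmetrization vanishes.\<close>

lemma exterior_deriv_connection_form:
  assumes "z \<in> config_space"
  shows "exterior_deriv (connection_form X) z u v = 0"
  unfolding exterior_deriv_def has_derivative_connection_form[OF assms, THEN frechet_derivative_at, symmetric]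
  by (simp add: mult.commute)

section \<open>Symmetric sums and Arnold's relation\<close>

lemma sum_swap12: "(\<Sum>i\<in>UNIV. \<Sum>j\<in>UNIV. \<Sum>k\<in>UNIV. f i j k)
    = (\<Sum>i\<in>UNIV. \<Sum>j\<in>UNIV. \<Sum>k\<in>UNIV. f j i k)"
  by (rule sum.swap)

lemma sum_swap23: "(\<Sum>i\<in>UNIV. \<Sum>j\<in>UNIV. \<Sum>k\<in>UNIV. f i j k)
    = (\<Sum>i\<in>UNIV. \<Sum>j\<in>UNIV. \<Sum>k\<in>UNIV. f i k j)"
  by (intro sum.cong refl) (rule sum.swap)

lemma sum_cyc: "(\<Sum>i\<in>UNIV. \<Sum>j\<in>UNIV. \<Sum>k\<in>UNIV. f i j k)
    = (\<Sum>i\<in>UNIV. \<Sum>j\<in>UNIV. \<Sum>k\<in>UNIV. f j k i)"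
  using sum_swap23[of f] sum_swap12[of "\<lambda>i j k. f i k j"] by simp

lemma vec_scale_if: "c *s (if b then x else 0) = (if b then c *s x else (0 :: complex ^ 'm))"
  by simp

text \<open>Each pair \<open>i < j\<close> is counted twice, hence the factor 1/2. Without the order
  on the indices, the sums can be renamed freely.\<close>

lemma connection_form_eq_sum_all:
  fixes X :: "'n::{finite,linorder} \<Rightarrow> 'n \<Rightarrow> 'n brauer"
  assumes sym: "\<And>i j. X j i = X i j" and diag: "\<And>i. X i i = 0"
  shows "connection_form X z v = (1/2) *s (\<Sum>i\<in>UNIV. \<Sum>j\<in>UNIV. omega i j z v *s X i j)"
proof -
  let ?F = "\<lambda>(i, j). omega i j z v *s X i j"
  have osym: "omega j i z v = omega i j z v" for i j
    unfolding omega_eq by (metis minus_diff_eq minus_divide_divide)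
  have "(\<Sum>i\<in>UNIV. \<Sum>j\<in>UNIV. omega i j z v *s X i j) = sum ?F UNIV"
    by (simp add: sum.cartesian_product)
  also have "UNIV = {(i, j). i < j} \<union> {(i, j). j < i} \<union> {(i::'n, j). i = j}"
    by auto
  also have "sum ?F \<dots> = sum ?F {(i, j). i < j} + sum ?F {(i, j). j < i} + sum ?F {(i, j). i = j}"
    by (subst sum.union_disjoint; (subst sum.union_disjoint)?) auto
  also have "sum ?F {(i, j). i = j} = 0"
    by (rule sum.neutral) (auto simp: diag)
  also have "sum ?F {(i, j). j < i} = sum ?F {(i, j). i < j}"
    by (rule sum.reindex_bij_witness[of _ prod.swap prod.swap]) (auto simp: sym osym)
  finally have "(\<Sum>i\<in>UNIV. \<Sum>j\<in>UNIV. omega i j z v *s X i j) = 2 *s connection_form X z v"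
    by (simp add: connection_form_def vec_eq_iff)
  then show ?thesis by simp
qed

text \<open>\<open>h i j k\<close> is the wedge product of \<open>omega i j\<close> and
  \<open>omega i k\<close> at \<open>u\<close> and \<open>v\<close>. In terms of the differences
  \<open>a\<close> and \<open>b\<close> the claim is an identity of rational functions with
  denominators built from \<open>a\<close>, \<open>b\<close> and \<open>a + b\<close>.\<close>

lemma arnold:
  fixes z u v :: "complex ^ 'n::finite"
  assumes "z $ i \<noteq> z $ j" "z $ i \<noteq> z $ k" "z $ j \<noteq> z $ k"
  defines "h \<equiv> \<lambda>i j k. omega i j z u * omega i k z v - omega i k z u * omega i j z v"
  shows "h i j k + h j k i + h k i j = 0"
proof -
  define a b where "a = z $ i - z $ j" and "b = z $ j - z $ k"
  have z: "z $ i - z $ j = a" "z $ j - z $ k = b" "z $ i - z $ k = a + b"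
    "z $ j - z $ i = - a" "z $ k - z $ j = - b" "z $ k - z $ i = - (a + b)"
    unfolding a_def b_def by simp_all
  have "a \<noteq> 0" "b \<noteq> 0" "a + b \<noteq> 0"
    using assms by (auto simp flip: z)
  then show ?thesis
    unfolding h_def omega_eq z by (simp add: divide_simps) algebra
qed

section \<open>A criterion for flatness\<close>

text \<open>
  The diagonal entries of \<open>X\<close> do not enter \<open>connection_form X\<close>; setting them to \<open>0\<close> lets the sums run
  over all pairs of indices.
\<close>

lemma flat_connection_formI:
  fixes X :: "'n::{finite,linorder} \<Rightarrow> 'n \<Rightarrow> 'n brauer"
  assumes sym: "\<And>i j. X j i = X i j" and diag: "\<And>i. X i i = 0"
    and disj: "\<And>i j k l. i \<noteq> j \<Longrightarrow> k \<noteq> l \<Longrightarrow> {i, j} \<inter> {k, l} = {} \<Longrightarrow> brauer_comm \<tau> (X i j) (X k l) = 0"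
    and four_term: "\<And>i j k. i \<noteq> j \<Longrightarrow> i \<noteq> k \<Longrightarrow> j \<noteq> k \<Longrightarrow> brauer_comm \<tau> (X i j) (X i k + X j k) = 0"
  shows "flat_connection \<tau> (connection_form X)"
  unfolding flat_connection_def
proof (intro conjI ballI allI)
  fix z v :: "(complex, 'n) vec" assume "z \<in> config_space"
  then show "(\<lambda>w. connection_form X w v) differentiable at z"
    by (blast intro: differentiableI has_derivative_connection_form)
next
  fix z u v :: "(complex, 'n) vec" assume z: "z \<in> config_space"
  define f g where "f = (\<lambda>i j. omega i j z u)" and "g = (\<lambda>i j. omega i j z v)"
  define C where "C = (\<lambda>i j k. brauer_comm \<tau> (X i j) (X i k))"
  have osym: "f j i = f i j" "g j i = g i j" for i j
    unfolding f_def g_def omega_eq by (metis minus_diff_eq minus_divide_divide)+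
  have C23: "C i k j = - C i j k" for i j k
    unfolding C_def by (rule brauer_comm_swap)
  \<comment> \<open>The four-term relation equates \<open>C i j k\<close> with minus the commutator
    of \<open>X i j\<close> and \<open>X j k\<close>, which is \<open>C j i k\<close> by symmetry of
    \<open>X\<close>. Together with \<open>C23\<close> this makes \<open>C\<close>
    alternating.\<close>
  have C12: "C j i k = - C i j k" for i j k
  proof (cases "i = j \<or> i = k \<or> j = k")
    case True
    then show ?thesis by (auto simp: C_def diag sym)
  next
    case False
    then have "brauer_comm \<tau> (X i j) (X i k) + brauer_comm \<tau> (X i j) (X j k) = 0"
      using four_term[of i j k] by (simp add: brauer_comm_add_right)
    then show ?thesis
      unfolding C_def sym[of i j] by (metis add.commute add_eq_0_iff)
  qed
  \<comment> \<open>One summand for each way the two pairs can share an index. If the pairs coincide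
    or an index is repeated within a pair, every surviving term is a commutator with 0 or of an
    element with itself.\<close>
  have D: "brauer_comm \<tau> (X i j) (X k l) =
      (if i = k then C i j l else 0) + (if i = l then C i j k else 0)
      + (if j = k then C j i l else 0) + (if j = l then C j i k else 0)" for i j k l
  proof (cases "i = j \<or> k = l")
    case True
    then show ?thesis by (auto simp: C_def diag)
  next
    case False
    then show ?thesis
      using disj[of i j k l] by (auto simp: C_def sym)
  qed
  \<comment> \<open>By \<open>D\<close> the curvature is a multiple of \<open>S\<close>.  As \<open>C\<close> is alternating, only the alternating part of
    its weights contributes to \<open>S\<close>, and that part is the left-hand side of Arnold's relation.\<close>
  define S where "S = (\<Sum>i\<in>UNIV. \<Sum>j\<in>UNIV. \<Sum>k\<in>UNIV. (f i j * g i k) *s C i j k)"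
  define h where "h = (\<lambda>i j k. f i j * g i k - f i k * g i j)"
  have "S = (\<Sum>i\<in>UNIV. \<Sum>j\<in>UNIV. \<Sum>k\<in>UNIV. (f i k * g i j) *s C i k j)"
    unfolding S_def by (rule sum_swap23)
  then have "S + S = (\<Sum>i\<in>UNIV. \<Sum>j\<in>UNIV. \<Sum>k\<in>UNIV. (f i j * g i k) *s C i j k)
      + (\<Sum>i\<in>UNIV. \<Sum>j\<in>UNIV. \<Sum>k\<in>UNIV. (f i k * g i j) *s C i k j)"
    unfolding S_def by (rule arg_cong2[OF refl])
  also have "\<dots> = (\<Sum>i\<in>UNIV. \<Sum>j\<in>UNIV. \<Sum>k\<in>UNIV. h i j k *s C i j k)" (is "_ = ?H")
    unfolding sum.distrib[symmetric] h_def
  proof (intro sum.cong refl)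
    fix i j k
    show "(f i j * g i k) *s C i j k + (f i k * g i j) *s C i k j = (f i j * g i k - f i k * g i j) *s C i j k"
      unfolding C23[of i j k] by (simp add: vec.scale_left_diff_distrib)
  qed
  finally have SH: "S + S = ?H" .
  have C_cyc: "C j k i = C i j k" "C k i j = C i j k" for i j k
    by (metis C12 C23 minus_minus)+
  \<comment> \<open>The second and third copies are renamed cyclically. As \<open>C\<close> is
    invariant under cyclic shifts, the three weights can be added under one sum.\<close>
  have "?H + ?H + ?H = ?H + (\<Sum>i\<in>UNIV. \<Sum>j\<in>UNIV. \<Sum>k\<in>UNIV. h j k i *s C j k i)
      + (\<Sum>i\<in>UNIV. \<Sum>j\<in>UNIV. \<Sum>k\<in>UNIV. h k i j *s C k i j)"
    using sum_cyc[of "\<lambda>i j k. h i j k *s C i j k"] sum_cyc[of "\<lambda>i j k. h j k i *s C j k i"] by simp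
  also have "\<dots> = (\<Sum>i\<in>UNIV. \<Sum>j\<in>UNIV. \<Sum>k\<in>UNIV. (h i j k + h j k i + h k i j) *s C i j k)"
    unfolding sum.distrib[symmetric]
  proof (intro sum.cong refl)
    fix i j k
    show "h i j k *s C i j k + h j k i *s C j k i + h k i j *s C k i j
        = (h i j k + h j k i + h k i j) *s C i j k"
      unfolding C_cyc[where i = i and j = j and k = k] vec.scale_left_distrib ..
  qed
  also have "\<dots> = 0"
  proof (intro sum.neutral ballI)
    fix i j k
    show "(h i j k + h j k i + h k i j) *s C i j k = 0"
    proof (cases "i = j \<or> i = k \<or> j = k")
      \<comment> \<open>Arnold's relation requires distinct indices; at repeated ones it is
        \<open>C\<close> that vanishes.\<close>
      case True
      then have "C i j k = 0" by (auto simp: C_def diag)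
      then show ?thesis by simp
    next
      case False
      then have "z $ i \<noteq> z $ j" "z $ i \<noteq> z $ k" "z $ j \<noteq> z $ k"
        using z by (auto simp: config_space_def)
      from arnold[OF this, of u v] show ?thesis by (simp add: h_def f_def g_def)
    qed
  qed
  finally have "3 *s ?H = 0" by (simp add: vec_eq_iff)
  then have "S + S = 0" unfolding SH by simp
  then have "2 *s S = 0" by (simp add: vec_eq_iff)
  then have "S = 0" by simp
  \<comment> \<open>Each summand of \<open>D\<close> collapses one of the four sums. Symmetry of
    \<open>f\<close> and \<open>g\<close>, and in \<open>t3\<close> and \<open>t4\<close> also the
    exchange of \<open>i\<close> and \<open>j\<close>, bring the result to the form of
    \<open>S\<close>.\<close>
  have t1: "(\<Sum>i\<in>UNIV. \<Sum>j\<in>UNIV. \<Sum>k\<in>UNIV. \<Sum>l\<in>UNIV.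
      (f i j * g k l) *s (if i = k then C i j l else 0)) = S"
    unfolding S_def vec_scale_if sum_delta_outer ..
  have t2: "(\<Sum>i\<in>UNIV. \<Sum>j\<in>UNIV. \<Sum>k\<in>UNIV. \<Sum>l\<in>UNIV.
      (f i j * g k l) *s (if i = l then C i j k else 0)) = S"
    unfolding S_def vec_scale_if by (simp, intro sum.cong refl, metis osym(2))
  have t3: "(\<Sum>i\<in>UNIV. \<Sum>j\<in>UNIV. \<Sum>k\<in>UNIV. \<Sum>l\<in>UNIV.
      (f i j * g k l) *s (if j = k then C j i l else 0)) = S"
    unfolding S_def vec_scale_if sum_delta_outer
    by (subst sum_swap12) (intro sum.cong refl, metis osym(1))
  have t4: "(\<Sum>i\<in>UNIV. \<Sum>j\<in>UNIV. \<Sum>k\<in>UNIV. \<Sum>l\<in>UNIV.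
      (f i j * g k l) *s (if j = l then C j i k else 0)) = S"
    unfolding S_def vec_scale_if sum.delta[OF finite] if_True
    by (subst sum_swap12) (simp, intro sum.cong refl, metis osym)
  \<comment> \<open>The factor 1/4 comes from the factor 1/2 in each of the two arguments.\<close>
  have "brauer_comm \<tau> (connection_form X z u) (connection_form X z v)
    = (1/4) *s (\<Sum>i\<in>UNIV. \<Sum>j\<in>UNIV. \<Sum>k\<in>UNIV. \<Sum>l\<in>UNIV.
        (f i j * g k l) *s brauer_comm \<tau> (X i j) (X k l))"
    unfolding connection_form_eq_sum_all[OF sym diag] f_def g_def
      brauer_comm_scale_left brauer_comm_sum_left
    unfolding brauer_comm_scale_right brauer_comm_sum_right
    by (simp add: vec.scale_sum_right)
  also have "\<dots> = (1/4) *s (S + S + S + S)"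
    unfolding D vec.scale_right_distrib sum.distrib t1 t2 t3 t4 ..
  also have "\<dots> = 0" using \<open>S = 0\<close> by simp
  finally show "exterior_deriv (connection_form X) z u v
    - brauer_wedge \<tau> (connection_form X) (connection_form X) z u v = 0"
    using z by (simp add: exterior_deriv_connection_form brauer_wedge_def brauer_comm_def)
qed

section \<open>The connection \<open>Omega_bar\<close>\<close>

lemma connection_form_scale: "connection_form (\<lambda>i j. c *s X i j) z v = c *s connection_form X z v"
  unfolding connection_form_def vec.scale_sum_right
  by (intro sum.cong refl) (auto simp: mult.commute)

lemma Omega_bar_eq: "Omega_bar \<kappa> = connection_form (\<lambda>i j. \<kappa> *s brauer_X i j)"
  by (intro ext) (simp add: Omega_bar_def connection_form_scale, simp add: connection_form_def brauer_X_def)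

theorem proposition3p2:
  fixes \<tau> \<kappa> :: complex
  assumes "CARD('n::{finite,linorder}) \<ge> 2"
  shows "flat_connection \<tau>
           (Omega_bar \<kappa> :: complex ^ ('n::{finite,linorder}) \<Rightarrow> complex ^ ('n::{finite,linorder}) \<Rightarrow> 'n brauer) \<and>
         symmetric_group_invariant \<tau>
           (Omega_bar \<kappa> :: complex ^ ('n::{finite,linorder}) \<Rightarrow> complex ^ ('n::{finite,linorder}) \<Rightarrow> 'n brauer)"
proof
  show "flat_connection \<tau> (Omega_bar \<kappa> :: (complex, 'n) vec \<Rightarrow> _)"
    unfolding Omega_bar_eq
  proof (rule flat_connection_formI)
    fix i j k l :: 'n
    show "\<kappa> *s brauer_X j i = \<kappa> *s brauer_X i j" by (simp only: brauer_X_commute[of i j])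
    show "\<kappa> *s brauer_X i i = 0" by (simp add: brauer_X_same)
    show "brauer_comm \<tau> (\<kappa> *s brauer_X i j) (\<kappa> *s brauer_X k l) = 0"
      if "i \<noteq> j" "k \<noteq> l" "{i, j} \<inter> {k, l} = {}"
      by (simp add: brauer_comm_scale_left brauer_comm_scale_right brauer_X_disjoint[OF that])
    show "brauer_comm \<tau> (\<kappa> *s brauer_X i j) (\<kappa> *s brauer_X i k + \<kappa> *s brauer_X j k) = 0"
      if "i \<noteq> j" "i \<noteq> k" "j \<noteq> k"
      unfolding vec.scale_right_distrib[symmetric] brauer_comm_scale_left brauer_comm_scale_right
        brauer_X_four_term[OF that] by simp
  qed
  show "symmetric_group_invariant \<tau> (Omega_bar \<kappa> :: (complex, 'n) vec \<Rightarrow> _)"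
    unfolding symmetric_group_invariant_def Omega_bar_eq
  \<comment> \<open>The witness is the coefficient family of \<open>Omega_bar\<close> with the
    scalar \<open>\<kappa>\<close> absorbed, so the equality of forms holds by reflexivity.\<close>
  proof (intro exI[of _ "\<lambda>i j. \<kappa> *s brauer_X i j"] conjI allI impI ballI refl)
    fix w :: "'n perm" and i j :: 'n
    show "\<kappa> *s brauer_X j i = \<kappa> *s brauer_X i j" by (simp only: brauer_X_commute[of i j])
    show "brauer_mult \<tau> (brauer_mult \<tau> (brauer_perm w) (\<kappa> *s brauer_X i j)) (brauer_perm (inverse w))
        = \<kappa> *s brauer_X (w \<langle>$\<rangle> i) (w \<langle>$\<rangle> j)"
      by (simp add: brauer_mult_scale_left brauer_mult_scale_right brauer_X_conj)
  qed
qed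

end
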